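(* Let $r$ and $N$ be positive integers such that $N\geq 3^{r^2+r}$. Then if $\{1,\ldots,N\}=A_1\cup\cdots\cup A_r$ is a partition of $\{1,\ldots,N\}$, we have \[\max\{R_2(A_i):1\leq i\leq r\}\geq \frac{N^{1/r}}{3^r}.\]
   Context: For $L\geq 1$, a finite increasing sequence of real numbers $a_1<\cdots<a_n$ (equivalently, a finite set of reals listed in increasing order) is called $L$-regular if there is a positive real number $X$ such that $X\leq a_{i+1}-a_i\leq LX$ for all $i=1,\ldots,n-1$. For a set $A$ of real numbers, $R_L(A)=\max\{|A'|:A'\subseteq A,\ A'\text{ is }L\text{-regular}\}$. *)

theory Defs
  imports Complex_Main "HOL-Library.Disjoint_Sets"
begin

text \<open>
  Sequences are 0-based lists. Sequences of length at most one are regular for every \<open>L\<close>.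
  The notion is intended for \<open>L \<ge> 1\<close>.
\<close>

definition regular_seq :: "real \<Rightarrow> real list \<Rightarrow> bool" where
  "regular_seq L a \<longleftrightarrow>
     sorted_wrt (<) a \<and>
     (\<exists>X>0. \<forall>i. Suc i < length a \<longrightarrow> X \<le> a ! Suc i - a ! i \<and> a ! Suc i - a ! i \<le> L * X)"

definition regular_set :: "real \<Rightarrow> real set \<Rightarrow> bool" where
  "regular_set L A \<longleftrightarrow> finite A \<and> regular_seq L (sorted_list_of_set A)"

text \<open>
  The maximum is taken over a finite non-empty set of naturals when \<open>A\<close> is finite
  (the empty set is regular); the value is only meaningful in that case.
\<close>

definition R :: "real \<Rightarrow> real set \<Rightarrow> nat" where
  "R L A = Max {card A' | A'. A' \<subseteq> A \<and> regular_set L A'}"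

lemma regular_set_empty: "regular_set L {}"
  by (auto simp: regular_set_def regular_seq_def intro: exI[of _ 1])

lemma R_attained:
  assumes "finite A"
  shows "\<exists>A'\<subseteq>A. regular_set L A' \<and> card A' = R L A"
proof -
  have "{card A' | A'. A' \<subseteq> A \<and> regular_set L A'} \<subseteq> card ` Pow A" by auto
  then have "finite {card A' | A'. A' \<subseteq> A \<and> regular_set L A'}"
    using assms by (meson finite_Pow_iff finite_imageI finite_subset)
  moreover have "{card A' | A'. A' \<subseteq> A \<and> regular_set L A'} \<noteq> {}"
    using regular_set_empty by blast
  ultimately have "R L A \<in> {card A' | A'. A' \<subseteq> A \<and> regular_set L A'}"
    unfolding R_def by (rule Max_in)
  then show ?thesis by auto
qed

end

(* Fix a target size K and suppose an interval of length at least (2 K)^s is covered by s colours;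
   fix one colour and put X = (2 K)^(s - 1). If it meets every block of X consecutive integers in
   the interval, choose its elements greedily: after x, take one in {x + X + 1..x + 2 X}. This
   produces K terms before the interval ends. Otherwise it misses a block of length X, and this
   block is covered by the other s - 1 colours. A block of length 1 cannot be covered by no
   colours, so the descent stops. For y = N^(1/r) and K = ceiling (y / 3^r), the hypothesis
   gives y >= 9, hence 2 K <= 2 (y / 3 + 1) <= y and (2 K)^r <= N. *)
theory Submission
  imports Defs
begin

lemma regular_set_image_real:
  fixes f :: "nat \<Rightarrow> nat"
  assumes "X > 0" and gap: "\<And>i. Suc i < K \<Longrightarrow> f i + X \<le> f (Suc i) \<and> f (Suc i) \<le> f i + 2 * X"
  shows "regular_set 2 (real ` f ` {..<K})" and "card (real ` f ` {..<K}) = K"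
proof -
  let ?xs = "map (\<lambda>i. real (f i)) [0..<K]"
  \<comment> \<open>Gaps of at least \<open>X > 0\<close> make \<open>f\<close> strictly increasing
    on the indices below \<open>K\<close>. So \<open>?xs\<close> is already the sorted enumeration
    of its set, and no elements coincide.\<close>
  have sorted: "sorted_wrt (<) ?xs"
  proof (subst sorted_wrt_iff_nth_Suc_transp)
    show "\<forall>i. Suc i < length ?xs \<longrightarrow> ?xs ! i < ?xs ! Suc i"
      using gap assms(1) by fastforce
  qed (simp add: transp_on_less)
  have set: "real ` f ` {..<K} = set ?xs" by (auto simp: image_image atLeast0LessThan)
  from sorted have "sorted_list_of_set (set ?xs) = ?xs"
    using sorted_list_of_set.idem_if_sorted_distinct strict_sorted_iff by blast
  moreover have "\<exists>X>0. \<forall>i. Suc i < length ?xs \<longrightarrow>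
      X \<le> ?xs ! Suc i - ?xs ! i \<and> ?xs ! Suc i - ?xs ! i \<le> 2 * X"
  proof (intro exI[of _ "real X"] conjI allI impI)
    fix i assume "Suc i < length ?xs"
    then have i: "Suc i < K" by simp
    with gap[OF i] show "real X \<le> ?xs ! Suc i - ?xs ! i" "?xs ! Suc i - ?xs ! i \<le> 2 * real X"
      by simp_all
  qed (use assms(1) in simp)
  ultimately show "regular_set 2 (real ` f ` {..<K})"
    unfolding regular_set_def regular_seq_def set using sorted by simp
  show "card (real ` f ` {..<K}) = K"
    unfolding set using sorted distinct_card[of ?xs] strict_sorted_iff[of ?xs] by simp
qed

lemma syndetic_imp_regular_subset:
  fixes B :: "nat set"
  assumes "X > 0" and "2 * K * X \<le> n"
    and meets: "\<And>p. {p<..p + X} \<subseteq> {m<..m + n} \<Longrightarrow> B \<inter> {p<..p + X} \<noteq> {}"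
  shows "\<exists>S\<subseteq>real ` B. regular_set 2 S \<and> card S = K"
proof -
  \<comment> \<open>Term 0 is sought in the first block of length \<open>X\<close>, and each later
    term moves the search by at most \<open>2 * X\<close>. Hence the block searched for term
    \<open>i\<close> ends by \<open>m + (2 * i + 1) * X\<close>, inside the interval.\<close>
  have room: "(2 * i + 1) * X \<le> n" if "i < K" for i
  proof -
    have "(2 * i + 1) * X \<le> 2 * K * X" using that by (intro mult_right_mono) auto
    then show ?thesis using assms(2) by linarith
  qed
  \<comment> \<open>Dependent choice yields an infinite sequence, while the interval has guaranteed
    room for \<open>K\<close> terms only. The guards leave the later values arbitrary.\<close>
  have "\<exists>f. \<forall>i. (i < K \<longrightarrow> f i \<in> B \<and> m < f i \<and> f i \<le> m + (2 * i + 1) * X) \<and>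
      (Suc i < K \<longrightarrow> f i + X \<le> f (Suc i) \<and> f (Suc i) \<le> f i + 2 * X)"
  proof (rule dependent_nat_choice)
    show "\<exists>x. 0 < K \<longrightarrow> x \<in> B \<and> m < x \<and> x \<le> m + (2 * 0 + 1) * X"
      using meets[of m] room[of 0] by fastforce
  next
    fix x i
    assume x: "i < K \<longrightarrow> x \<in> B \<and> m < x \<and> x \<le> m + (2 * i + 1) * X"
    show "\<exists>y. (Suc i < K \<longrightarrow> y \<in> B \<and> m < y \<and> y \<le> m + (2 * Suc i + 1) * X) \<and>
        (Suc i < K \<longrightarrow> x + X \<le> y \<and> y \<le> x + 2 * X)"
    proof (cases "Suc i < K")
      case True
      with x have x': "m < x" "x + 2 * X \<le> m + (2 * Suc i + 1) * X"
        by (auto simp: algebra_simps)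
      \<comment> \<open>Skipping \<open>X\<close> integers after \<open>x\<close> forces a gap of at
        least \<open>X\<close>; the block length caps it at \<open>2 * X\<close>.\<close>
      with room[OF True] have "{x + X<..x + X + X} \<subseteq> {m<..m + n}" by auto
      from meets[OF this] obtain y where "y \<in> B" "x + X < y" "y \<le> x + X + X" by auto
      with x' show ?thesis by (intro exI[of _ y]) auto
    qed auto
  qed
  then obtain f where f: "\<And>i. i < K \<Longrightarrow> f i \<in> B"
    "\<And>i. Suc i < K \<Longrightarrow> f i + X \<le> f (Suc i) \<and> f (Suc i) \<le> f i + 2 * X" by blast
  show ?thesis
    using regular_set_image_real[of X K f, OF assms(1) f(2)] f(1)
    by (intro exI[of _ "real ` f ` {..<K}"]) auto
qed

lemma covered_interval_regular_subset:
  fixes A :: "'a \<Rightarrow> nat set"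
  assumes "finite C" and "K > 0" and "(2 * K) ^ card C \<le> n" and "{m<..m + n} \<subseteq> (\<Union>i\<in>C. A i)"
  shows "\<exists>i\<in>C. \<exists>S\<subseteq>real ` A i. regular_set 2 S \<and> card S = K"
  using assms(1,3,4)
\<comment> \<open>The position and length must vary, since the hypothesis is applied to the missed
  block.\<close>
proof (induction C arbitrary: m n rule: finite_induct)
  \<comment> \<open>Here \<open>n\<close> is at least \<open>(2 * K) ^ 0 = 1\<close>, so a nonempty
    interval would lie in an empty union.\<close>
  case empty
  then show ?case by simp
next
  case (insert c C)
  let ?X = "(2 * K) ^ card C"
  show ?case
  proof (cases "\<forall>p. {p<..p + ?X} \<subseteq> {m<..m + n} \<longrightarrow> A c \<inter> {p<..p + ?X} \<noteq> {}")
    case True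
    have "2 * K * ?X \<le> n" using insert.prems(1) insert.hyps by simp
    then have "\<exists>S\<subseteq>real ` A c. regular_set 2 S \<and> card S = K"
      using True \<open>K > 0\<close> by (intro syndetic_imp_regular_subset[of ?X]) auto
    then show ?thesis by blast
  next
    case False
    then obtain p where "{p<..p + ?X} \<subseteq> {m<..m + n}" "A c \<inter> {p<..p + ?X} = {}" by blast
    then have "{p<..p + ?X} \<subseteq> (\<Union>i\<in>C. A i)" using insert.prems(2) by blast
    from insert.IH[OF order_refl this] show ?thesis by blast
  qed
qed

text \<open>\<open>Max\<close> bounds its elements only over a finite set; the candidate sizes form
  one because \<open>A\<close> has finitely many subsets.\<close>

lemma card_le_R:
  assumes "finite A" and "S \<subseteq> A" and "regular_set L S"
  shows "card S \<le> R L A"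
  unfolding R_def
proof (rule Max_ge)
  have "{card A' | A'. A' \<subseteq> A \<and> regular_set L A'} \<subseteq> card ` Pow A" by auto
  then show "finite {card A' | A'. A' \<subseteq> A \<and> regular_set L A'}"
    using assms(1) by (meson finite_Pow_iff finite_imageI finite_subset)
qed (use assms in blast)

theorem theorem1:
  fixes r N :: nat and A :: "nat \<Rightarrow> nat set"
  assumes "r > 0" and "N > 0"
    and "N \<ge> 3 ^ (r\<^sup>2 + r)"
    and "(\<Union>i\<in>{1..r}. A i) = {1..N}"
    and "disjoint_family_on A {1..r}"
  shows "real (Max {R 2 (real ` A i) | i. i \<in> {1..r}}) \<ge> real N powr (1 / real r) / 3 ^ r"
proof -
  define y where "y = real N powr (1 / real r)"
  have y_pos: "y > 0" using assms(2) by (simp add: y_def)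
  have y_pow: "y ^ r = real N"
    using assms(1,2) y_pos by (simp add: y_def powr_powr flip: powr_realpow)
  define K where "K = nat \<lceil>y / 3 ^ r\<rceil>"
  have K: "y / 3 ^ r \<le> real K" "real K \<le> y / 3 ^ r + 1" "K > 0"
    using y_pos by (auto simp: K_def intro: real_nat_ceiling_ge)
  \<comment> \<open>Since \<open>r\<^sup>2 + r\<close> is \<open>(r + 1) * r\<close>, taking r-th
    roots gives \<open>y\<close> \<ge> \<open>3 ^ Suc r\<close>.\<close>
  have "(3 ^ Suc r) ^ r \<le> real N"
  proof -
    have "(3 ^ Suc r) ^ r = real (3 ^ (r\<^sup>2 + r))"
      by (simp add: power_add power_mult_distrib power2_eq_square flip: power_mult)
    then show ?thesis using assms(3) of_nat_le_iff by metis
  qed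
  then have "3 ^ Suc r \<le> y"
    using y_pow y_pos assms(1) by (metis less_imp_le power_mono_iff zero_le_numeral zero_le_power)
  moreover have three: "(3::real) ^ r \<ge> 3" using assms(1) self_le_power[of "3::real" r] by simp
  ultimately have "y \<ge> 9" by simp
  have "y / 3 ^ r \<le> y / 3" using three y_pos by (intro divide_left_mono) auto
  with K(2) \<open>y \<ge> 9\<close> have "real (2 * K) \<le> y" by simp
  then have "real (2 * K) ^ r \<le> y ^ r" by (intro power_mono) auto
  then have "real ((2 * K) ^ r) \<le> real N" using y_pow by simp
  then have "(2 * K) ^ card {1..r} \<le> N" unfolding of_nat_le_iff by simp
  moreover have "{0<..0 + N} \<subseteq> (\<Union>i\<in>{1..r}. A i)" using assms(4) by auto
  ultimately obtain i S where i: "i \<in> {1..r}" and S: "S \<subseteq> real ` A i" "regular_set 2 S" "card S = K"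
    using covered_interval_regular_subset[of "{1..r}" K N 0 A] K(3) by blast
  have "finite (A i)" using i assms(4) by (metis UN_upper finite_atLeastAtMost finite_subset)
  with S have "K \<le> R 2 (real ` A i)" using card_le_R by blast
  also have "\<dots> \<le> Max {R 2 (real ` A i) | i. i \<in> {1..r}}"
    using i by (intro Max_ge) auto
  finally show ?thesis using K(1) unfolding y_def by linarith
qed

end
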